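(* Let $A$ and $B$ be associative unital algebras over $\mathbb{C}$, with products $\mu_A: A\otimes A\to A$, $\mu_B: B\otimes B\to B$ and units $1_A$, $1_B$. Let $\sigma: A\otimes B\to B\otimes A$ be a linear map such that $$\sigma\circ(\mu_A\otimes \mathrm{id}_B)=(\mathrm{id}_B\otimes\mu_A)\circ\sigma_{12}\circ\sigma_{23}\quad\text{on } A\otimes A\otimes B,$$ $$\sigma\circ(\mathrm{id}_A\otimes \mu_B)=(\mu_B\otimes\mathrm{id}_A)\circ\sigma_{23}\circ\sigma_{12}\quad\text{on } A\otimes B\otimes B,$$ $$\sigma(1_A\otimes b)=b\otimes 1_A,\qquad \sigma(a\otimes 1_B)=1_B\otimes a\qquad\text{for all } a\in A,\ b\in B.$$ Let $\varepsilon_A: A\to\mathbb{C}$ be a counit, i.e. a homomorphism of unital algebras. For $a\in A$ let $Op(a): B\to B$ be the linear operator defined by $$Op(a)(b)=a\triangleright b:=(\mathrm{id}_B\otimes\varepsilon_A)\circ\sigma(a\otimes b),\qquad b\in B,$$ where $B\otimes\mathbb{C}$ is identified with $B$ via $b\otimes 1_{\mathbb{C}}\mapsto b$. Then the map $a\mapsto Op(a)$ defines a representation of the algebra $A$ in (the vector space of) the algebra $B$: for all $a,b\in A$, $$Op(ab)=Op(a)\,Op(b),\qquad Op(1_A)=I,$$ where $I$ is the identity operator on $B$.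
   Context: All tensor products are over $\mathbb{C}$. The notation $\sigma_{12}$ (respectively $\sigma_{23}$) means that $\sigma$ is applied to the tensor factors in positions 1, 2 (respectively 2, 3) of a triple tensor product, with the identity on the remaining factor. Thus on $A\otimes A\otimes B$ one has $\sigma_{23}=\mathrm{id}_A\otimes\sigma: A\otimes A\otimes B\to A\otimes B\otimes A$, followed by $\sigma_{12}=\sigma\otimes\mathrm{id}_A: A\otimes B\otimes A\to B\otimes A\otimes A$. On $A\otimes B\otimes B$ one has $\sigma_{12}=\sigma\otimes\mathrm{id}_B: A\otimes B\otimes B\to B\otimes A\otimes B$, followed by $\sigma_{23}=\mathrm{id}_B\otimes\sigma: B\otimes A\otimes B\to B\otimes B\otimes A$. *)

theory Defs
  imports Complex_Main "HOL-Library.Poly_Mapping"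
begin

section \<open>Complex vector spaces and unital algebras\<close>

class complex_vector = ab_group_add +
  fixes scaleC :: "complex \<Rightarrow> 'a \<Rightarrow> 'a"  (infixr \<open>*\<^sub>C\<close> 75)
  assumes scaleC_add_right: "c *\<^sub>C (x + y) = c *\<^sub>C x + c *\<^sub>C y"
    and scaleC_add_left: "(c + d) *\<^sub>C x = c *\<^sub>C x + d *\<^sub>C x"
    and scaleC_scaleC: "c *\<^sub>C d *\<^sub>C x = (c * d) *\<^sub>C x"
    and scaleC_one: "1 *\<^sub>C x = x"

global_interpretation complex_vector: vector_space "scaleC :: complex \<Rightarrow> 'a \<Rightarrow> 'a::complex_vector"
  by unfold_locales (simp_all add: scaleC_add_right scaleC_add_left scaleC_scaleC scaleC_one)

abbreviation clinear :: "('a::complex_vector \<Rightarrow> 'b::complex_vector) \<Rightarrow> bool"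
  where "clinear \<equiv> Vector_Spaces.linear scaleC scaleC"

definition cbilinear :: "('a::complex_vector \<Rightarrow> 'b::complex_vector \<Rightarrow> 'c::complex_vector) \<Rightarrow> bool"
  where "cbilinear f \<longleftrightarrow> (\<forall>x. clinear (f x)) \<and> (\<forall>y. clinear (\<lambda>x. f x y))"

text \<open>The class \<^class>\<open>ring_1\<close> is avoided because it excludes the zero algebra.\<close>

class complex_unital_algebra = complex_vector + ring + monoid_mult +
  assumes mult_scaleC_left: "(c *\<^sub>C x) * y = c *\<^sub>C (x * y)"
    and mult_scaleC_right: "x * (c *\<^sub>C y) = c *\<^sub>C (x * y)"

instantiation complex :: complex_unital_algebra
begin

definition scaleC_complex :: "complex \<Rightarrow> complex \<Rightarrow> complex"
  where "scaleC_complex c x = c * x"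

instance
  by standard (simp_all add: scaleC_complex_def algebra_simps)

end

definition unital_algebra_hom ::
    "('a::complex_unital_algebra \<Rightarrow> 'b::complex_unital_algebra) \<Rightarrow> bool"
  where "unital_algebra_hom f \<longleftrightarrow>
    clinear f \<and> (\<forall>x y. f (x * y) = f x * f y) \<and> f 1 = 1"

text \<open>The first two conjuncts say that \<open>\<rho>\<close> is a linear map into the space of linear endomorphisms.\<close>

definition algebra_representation ::
    "('a::complex_unital_algebra \<Rightarrow> 'v::complex_vector \<Rightarrow> 'v) \<Rightarrow> bool"
  where "algebra_representation \<rho> \<longleftrightarrow>
    (\<forall>a. clinear (\<rho> a)) \<and> (\<forall>v. clinear (\<lambda>a. \<rho> a v)) \<and>
    (\<forall>a b. \<rho> (a * b) = \<rho> a \<circ> \<rho> b) \<and> \<rho> 1 = id"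

lemma clinear_iff:
  "clinear f \<longleftrightarrow> (\<forall>x y. f (x + y) = f x + f y) \<and> (\<forall>c x. f (c *\<^sub>C x) = c *\<^sub>C f x)"
  by (simp add: Vector_Spaces.linear_iff complex_vector.vector_space_axioms)

lemma clinear_zero: "clinear f \<Longrightarrow> f 0 = 0"
  by (metis clinear_iff complex_vector.scale_zero_left)

lemma clinear_diff: "clinear f \<Longrightarrow> f (x - y) = f x - f y"
  by (metis clinear_iff add_diff_cancel_right' diff_add_cancel)


section \<open>The tensor product\<close>

text \<open>The tensor product over \<open>\<complex>\<close> is the free vector space on \<open>'a \<times> 'b\<close>, that is
  \<open>('a \<times> 'b) \<Rightarrow>\<^sub>0 complex\<close>, modulo the subspace spanned by the bilinearity relators.\<close>

instantiation poly_mapping :: (type, complex_vector) complex_vector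
begin

lift_definition scaleC_poly_mapping :: "complex \<Rightarrow> ('a \<Rightarrow>\<^sub>0 'b) \<Rightarrow> 'a \<Rightarrow>\<^sub>0 'b"
  is "\<lambda>c p k. c *\<^sub>C p k"
  by (erule rev_finite_subset) auto

instance
  by standard (transfer; simp add: fun_eq_iff scaleC_add_right scaleC_add_left scaleC_scaleC scaleC_one)+

end

inductive_set tensor_relators ::
    "(('a::complex_vector \<times> 'b::complex_vector) \<Rightarrow>\<^sub>0 complex) set"
  where
    add_left: "Poly_Mapping.single (x + x', y) 1
      - (Poly_Mapping.single (x, y) 1 + Poly_Mapping.single (x', y) 1) \<in> tensor_relators"
  | add_right: "Poly_Mapping.single (x, y + y') 1
      - (Poly_Mapping.single (x, y) 1 + Poly_Mapping.single (x, y') 1) \<in> tensor_relators"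
  | scale_left: "Poly_Mapping.single (c *\<^sub>C x, y) 1
      - c *\<^sub>C Poly_Mapping.single (x, y) 1 \<in> tensor_relators"
  | scale_right: "Poly_Mapping.single (x, c *\<^sub>C y) 1
      - c *\<^sub>C Poly_Mapping.single (x, y) 1 \<in> tensor_relators"

definition tensor_eq ::
    "(('a::complex_vector \<times> 'b::complex_vector) \<Rightarrow>\<^sub>0 complex) \<Rightarrow> (('a \<times> 'b) \<Rightarrow>\<^sub>0 complex) \<Rightarrow> bool"
  where "tensor_eq p q \<longleftrightarrow> p - q \<in> complex_vector.span tensor_relators"

lemma equivp_tensor_eq: "equivp tensor_eq"
proof (rule equivpI)
  show "reflp tensor_eq"
    by (simp add: reflp_def tensor_eq_def complex_vector.span_zero)
  show "symp tensor_eq"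
    unfolding symp_def tensor_eq_def using complex_vector.span_neg by fastforce
  show "transp tensor_eq"
    unfolding transp_def tensor_eq_def using complex_vector.span_add by fastforce
qed

quotient_type (overloaded) ('a, 'b) tensor =
  "('a::complex_vector \<times> 'b::complex_vector) \<Rightarrow>\<^sub>0 complex" / tensor_eq
  by (rule equivp_tensor_eq)

type_notation tensor (infixr \<open>\<otimes>\<close> 70)

instantiation tensor :: (complex_vector, complex_vector) complex_vector
begin

lift_definition zero_tensor :: "'a \<otimes> 'b" is 0 .

lift_definition plus_tensor :: "'a \<otimes> 'b \<Rightarrow> 'a \<otimes> 'b \<Rightarrow> 'a \<otimes> 'b" is plus
  unfolding tensor_eq_def add_diff_add by (rule complex_vector.span_add)

lift_definition uminus_tensor :: "'a \<otimes> 'b \<Rightarrow> 'a \<otimes> 'b" is uminus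
  unfolding tensor_eq_def minus_diff_minus by (rule complex_vector.span_neg)

lift_definition minus_tensor :: "'a \<otimes> 'b \<Rightarrow> 'a \<otimes> 'b \<Rightarrow> 'a \<otimes> 'b" is minus
  unfolding tensor_eq_def using complex_vector.span_diff by (fastforce simp: algebra_simps)

lift_definition scaleC_tensor :: "complex \<Rightarrow> 'a \<otimes> 'b \<Rightarrow> 'a \<otimes> 'b" is scaleC
  unfolding tensor_eq_def complex_vector.scale_right_diff_distrib[symmetric]
  by (rule complex_vector.span_scale)

instance
  by standard (transfer, simp add: tensor_eq_def complex_vector.span_zero algebra_simps)+

end

lift_definition tensor_of :: "'a::complex_vector \<Rightarrow> 'b::complex_vector \<Rightarrow> 'a \<otimes> 'b"  (infixr \<open>\<otimes>\<close> 70)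
  is "\<lambda>x y. Poly_Mapping.single (x, y) 1" .

lemma cbilinear_tensor_of: "cbilinear tensor_of"
  unfolding cbilinear_def clinear_iff
  by (intro conjI allI; transfer)
    (auto simp: tensor_eq_def intro!: complex_vector.span_base tensor_relators.intros)

lemma tensor_of_simps:
  "(x + x') \<otimes> y = x \<otimes> y + x' \<otimes> y"
  "x \<otimes> (y + y') = x \<otimes> y + x \<otimes> y'"
  "(c *\<^sub>C x) \<otimes> y = c *\<^sub>C (x \<otimes> y)"
  "x \<otimes> (c *\<^sub>C y) = c *\<^sub>C (x \<otimes> y)"
  using cbilinear_tensor_of unfolding cbilinear_def clinear_iff by blast+


section \<open>Maps out of tensor products\<close>

definition free_lift :: "('x \<Rightarrow> 'v::complex_vector) \<Rightarrow> ('x \<Rightarrow>\<^sub>0 complex) \<Rightarrow> 'v"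
  where "free_lift f p = (\<Sum>k\<in>Poly_Mapping.keys p. Poly_Mapping.lookup p k *\<^sub>C f k)"

text \<open>For bilinear \<open>f\<close> the value does not depend on the representative, and \<open>tensor_lift f\<close> is
  the linear map induced by \<open>f\<close>; for other \<open>f\<close> it is meaningless.\<close>

definition tensor_lift ::
    "('a::complex_vector \<Rightarrow> 'b::complex_vector \<Rightarrow> 'c::complex_vector) \<Rightarrow> 'a \<otimes> 'b \<Rightarrow> 'c"
  where "tensor_lift f t = free_lift (\<lambda>(x, y). f x y) (rep_tensor t)"

lemma free_lift_superset:
  assumes "finite S" "Poly_Mapping.keys p \<subseteq> S"
  shows "free_lift f p = (\<Sum>k\<in>S. Poly_Mapping.lookup p k *\<^sub>C f k)"
  unfolding free_lift_def
  by (rule sum.mono_neutral_left) (use assms in \<open>auto simp: in_keys_iff\<close>)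

lemma lookup_scaleC: "Poly_Mapping.lookup (c *\<^sub>C p) k = c *\<^sub>C Poly_Mapping.lookup p k"
  by transfer simp

lemma clinear_free_lift: "clinear (free_lift f)"
  unfolding clinear_iff
proof (intro conjI allI)
  fix p q :: "'a \<Rightarrow>\<^sub>0 complex" and c
  let ?S = "Poly_Mapping.keys p \<union> Poly_Mapping.keys q"
  show "free_lift f (p + q) = free_lift f p + free_lift f q"
    using Poly_Mapping.keys_add[of p q]
    by (simp add: free_lift_superset[of ?S] lookup_add scaleC_add_left sum.distrib)
  have "Poly_Mapping.keys (c *\<^sub>C p) \<subseteq> Poly_Mapping.keys p"
    by (auto simp: in_keys_iff lookup_scaleC)
  then show "free_lift f (c *\<^sub>C p) = c *\<^sub>C free_lift f p"
    by (simp add: free_lift_superset[of "Poly_Mapping.keys p"] lookup_scaleC scaleC_complex_def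
        complex_vector.scale_sum_right scaleC_scaleC)
qed

lemma free_lift_single: "free_lift f (Poly_Mapping.single k 1) = f k"
  by (simp add: free_lift_def scaleC_one)

lemma free_lift_cong:
  assumes "cbilinear f" "tensor_eq p q"
  shows "free_lift (\<lambda>(x, y). f x y) p = free_lift (\<lambda>(x, y). f x y) q"
proof -
  let ?F = "free_lift (\<lambda>(x, y). f x y)"
  note lin = clinear_free_lift[of "\<lambda>(x, y). f x y"]
  have F: "?F (u + v) = ?F u + ?F v" "?F (c *\<^sub>C u) = c *\<^sub>C ?F u" "?F (u - v) = ?F u - ?F v" for u v c
    using lin clinear_diff[OF lin] by (simp_all add: clinear_iff)
  have "p - q \<in> complex_vector.span tensor_relators"
    using assms(2) by (simp add: tensor_eq_def)
  then have "?F (p - q) = 0"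
  proof (induction rule: complex_vector.span_induct_alt)
    case base
    show ?case by (rule clinear_zero[OF lin])
  next
    case (step c r s)
    have "?F r = 0"
      using step(1) assms(1)
      by cases (simp_all add: F free_lift_single cbilinear_def clinear_iff)
    with step show ?case by (simp add: F)
  qed
  then show ?thesis by (simp add: F)
qed

lemma tensor_eq_rep_abs: "tensor_eq (rep_tensor (abs_tensor p)) p"
  by (rule rep_abs_rsp_left[OF Quotient3_tensor]) (rule equivp_reflp[OF equivp_tensor_eq])

lemma tensor_lift_abs:
  "cbilinear f \<Longrightarrow> tensor_lift f (abs_tensor p) = free_lift (\<lambda>(x, y). f x y) p"
  unfolding tensor_lift_def by (intro free_lift_cong tensor_eq_rep_abs)

lemma clinear_tensor_lift:
  assumes "cbilinear f"
  shows "clinear (tensor_lift f)"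
  unfolding clinear_iff
proof (intro conjI allI)
  fix s t :: "'a \<otimes> 'b" and c
  obtain p q where pq: "s = abs_tensor p" "t = abs_tensor q"
    by (metis Quotient3_tensor Quotient3_abs_rep)
  show "tensor_lift f (s + t) = tensor_lift f s + tensor_lift f t"
    using clinear_free_lift[of "\<lambda>(x, y). f x y"]
    by (simp add: pq plus_tensor.abs_eq tensor_lift_abs[OF assms] clinear_iff)
  show "tensor_lift f (c *\<^sub>C s) = c *\<^sub>C tensor_lift f s"
    using clinear_free_lift[of "\<lambda>(x, y). f x y"]
    by (simp add: pq scaleC_tensor.abs_eq tensor_lift_abs[OF assms] clinear_iff)
qed

lemma tensor_lift_tensor_of: "cbilinear f \<Longrightarrow> tensor_lift f (x \<otimes> y) = f x y"
  by (simp add: tensor_of.abs_eq tensor_lift_abs free_lift_single)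

lemma tensor_induct [case_names zero step]:
  assumes "P 0" "\<And>c x y t. P t \<Longrightarrow> P (c *\<^sub>C (x \<otimes> y) + t)"
  shows "P t"
proof -
  have "P (abs_tensor p)" for p
  proof (induction p rule: update_induct)
    case const
    then show ?case using assms(1) by (simp add: zero_tensor.abs_eq)
  next
    case (update p k c)
    obtain x y where k: "k = (x, y)" by (cases k)
    have "Poly_Mapping.update k c p = c *\<^sub>C Poly_Mapping.single k 1 + p"
      using update by (intro poly_mapping_eqI)
        (auto simp: lookup_update lookup_add lookup_scaleC lookup_single when_def scaleC_complex_def in_keys_iff)
    then have "abs_tensor (Poly_Mapping.update k c p) = c *\<^sub>C (x \<otimes> y) + abs_tensor p"
      by (simp add: k plus_tensor.abs_eq scaleC_tensor.abs_eq tensor_of.abs_eq)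
    then show ?case using assms(2) update by simp
  qed
  then show ?thesis by (metis Quotient3_tensor Quotient3_abs_rep)
qed

lemma clinear_tensor_eqI:
  assumes "clinear f" "clinear g" "\<And>x y. f (x \<otimes> y) = g (x \<otimes> y)"
  shows "f = g"
proof
  fix t show "f t = g t"
    by (induction t rule: tensor_induct)
      (use assms in \<open>simp_all add: clinear_zero[OF assms(1)] clinear_zero[OF assms(2)] clinear_iff\<close>)
qed

definition tensor_map ::
    "('a::complex_vector \<Rightarrow> 'c::complex_vector) \<Rightarrow> ('b::complex_vector \<Rightarrow> 'd::complex_vector)
      \<Rightarrow> 'a \<otimes> 'b \<Rightarrow> 'c \<otimes> 'd"  (infixr \<open>\<otimes>\<^sub>m\<close> 70)
  where "f \<otimes>\<^sub>m g = tensor_lift (\<lambda>x y. f x \<otimes> g y)"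

definition tensor_assoc ::
    "('a::complex_vector \<otimes> 'b::complex_vector) \<otimes> 'c::complex_vector \<Rightarrow> 'a \<otimes> ('b \<otimes> 'c)"
  where "tensor_assoc = tensor_lift (\<lambda>t z. tensor_lift (\<lambda>x y. x \<otimes> (y \<otimes> z)) t)"

definition tensor_assoc_inv ::
    "'a::complex_vector \<otimes> ('b::complex_vector \<otimes> 'c::complex_vector) \<Rightarrow> ('a \<otimes> 'b) \<otimes> 'c"
  where "tensor_assoc_inv = tensor_lift (\<lambda>x. tensor_lift (\<lambda>y z. (x \<otimes> y) \<otimes> z))"

definition tensor_unit_right :: "'b::complex_vector \<otimes> complex \<Rightarrow> 'b"
  where "tensor_unit_right = tensor_lift (\<lambda>y c. c *\<^sub>C y)"

definition alg_mult :: "'a::complex_unital_algebra \<otimes> 'a \<Rightarrow> 'a"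
  where "alg_mult = tensor_lift (*)"

text \<open>Triple tensor products are bracketed to the left.\<close>

definition leg12 ::
    "('a::complex_vector \<otimes> 'b::complex_vector \<Rightarrow> 'd::complex_vector \<otimes> 'e::complex_vector)
      \<Rightarrow> ('a \<otimes> 'b) \<otimes> 'c::complex_vector \<Rightarrow> ('d \<otimes> 'e) \<otimes> 'c"
  where "leg12 \<sigma> = \<sigma> \<otimes>\<^sub>m id"

definition leg23 ::
    "('b::complex_vector \<otimes> 'c::complex_vector \<Rightarrow> 'd::complex_vector \<otimes> 'e::complex_vector)
      \<Rightarrow> ('a::complex_vector \<otimes> 'b) \<otimes> 'c \<Rightarrow> ('a \<otimes> 'd) \<otimes> 'e"
  where "leg23 \<sigma> = tensor_assoc_inv \<circ> (id \<otimes>\<^sub>m \<sigma>) \<circ> tensor_assoc"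

definition Op ::
    "('a::complex_vector \<otimes> 'b::complex_vector \<Rightarrow> 'b \<otimes> 'a) \<Rightarrow> ('a \<Rightarrow> complex) \<Rightarrow> 'a \<Rightarrow> 'b \<Rightarrow> 'b"
  where "Op \<sigma> \<epsilon> a b = tensor_unit_right ((id \<otimes>\<^sub>m \<epsilon>) (\<sigma> (a \<otimes> b)))"

lemma tensor_map_tensor_of:
  assumes "clinear f" "clinear g"
  shows "(f \<otimes>\<^sub>m g) (x \<otimes> y) = f x \<otimes> g y"
    and "clinear (f \<otimes>\<^sub>m g)"
proof -
  have "cbilinear (\<lambda>x y. f x \<otimes> g y)"
    using assms by (simp add: cbilinear_def clinear_iff tensor_of_simps)
  then show "(f \<otimes>\<^sub>m g) (x \<otimes> y) = f x \<otimes> g y" "clinear (f \<otimes>\<^sub>m g)"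
    by (simp_all add: tensor_map_def tensor_lift_tensor_of clinear_tensor_lift)
qed

lemma tensor_assoc_tensor_of:
  fixes x :: "'a::complex_vector" and y :: "'b::complex_vector" and z :: "'c::complex_vector"
  shows "tensor_assoc ((x \<otimes> y) \<otimes> z) = x \<otimes> (y \<otimes> z)"
    and "clinear (tensor_assoc :: ('a \<otimes> 'b) \<otimes> 'c \<Rightarrow> _)"
proof -
  have inner: "cbilinear (\<lambda>(x::'a) (y::'b). x \<otimes> (y \<otimes> z))" for z :: 'c
    by (simp add: cbilinear_def clinear_iff tensor_of_simps)
  have outer: "cbilinear (\<lambda>t (z::'c). tensor_lift (\<lambda>(x::'a) (y::'b). x \<otimes> (y \<otimes> z)) t)"
    unfolding cbilinear_def
  proof (intro conjI allI)
    show "clinear (\<lambda>t. tensor_lift (\<lambda>(x::'a) (y::'b). x \<otimes> (y \<otimes> z)) t)" for z :: 'c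
      by (rule clinear_tensor_lift[OF inner])
    fix t :: "'a \<otimes> 'b"
    show "clinear (\<lambda>z::'c. tensor_lift (\<lambda>x y. x \<otimes> (y \<otimes> z)) t)"
    proof (induction t rule: tensor_induct)
      case zero
      then show ?case
        by (simp add: clinear_zero[OF clinear_tensor_lift[OF inner]] clinear_iff)
    next
      case (step c x y t)
      then show ?case
        using clinear_tensor_lift[OF inner]
        by (simp add: tensor_lift_tensor_of[OF inner] tensor_of_simps clinear_iff algebra_simps)
    qed
  qed
  show "tensor_assoc ((x \<otimes> y) \<otimes> z) = x \<otimes> (y \<otimes> z)"
    by (simp add: tensor_assoc_def tensor_lift_tensor_of[OF outer] tensor_lift_tensor_of[OF inner])
  show "clinear (tensor_assoc :: ('a \<otimes> 'b) \<otimes> 'c \<Rightarrow> _)"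
    by (simp add: tensor_assoc_def clinear_tensor_lift[OF outer])
qed

lemma tensor_assoc_inv_tensor_of:
  fixes x :: "'a::complex_vector" and y :: "'b::complex_vector" and z :: "'c::complex_vector"
  shows "tensor_assoc_inv (x \<otimes> (y \<otimes> z)) = (x \<otimes> y) \<otimes> z"
    and "clinear (tensor_assoc_inv :: 'a \<otimes> ('b \<otimes> 'c) \<Rightarrow> _)"
proof -
  have inner: "cbilinear (\<lambda>(y::'b) (z::'c). (x \<otimes> y) \<otimes> z)" for x :: 'a
    by (simp add: cbilinear_def clinear_iff tensor_of_simps)
  have outer: "cbilinear (\<lambda>(x::'a). tensor_lift (\<lambda>(y::'b) (z::'c). (x \<otimes> y) \<otimes> z))"
    unfolding cbilinear_def
  proof (intro conjI allI)
    show "clinear (tensor_lift (\<lambda>(y::'b) (z::'c). (x \<otimes> y) \<otimes> z))" for x :: 'a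
      by (rule clinear_tensor_lift[OF inner])
    fix t :: "'b \<otimes> 'c"
    show "clinear (\<lambda>x::'a. tensor_lift (\<lambda>y z. (x \<otimes> y) \<otimes> z) t)"
    proof (induction t rule: tensor_induct)
      case zero
      then show ?case
        by (simp add: clinear_zero[OF clinear_tensor_lift[OF inner]] clinear_iff)
    next
      case (step c y z t)
      then show ?case
        using clinear_tensor_lift[OF inner]
        by (simp add: tensor_lift_tensor_of[OF inner] tensor_of_simps clinear_iff algebra_simps)
    qed
  qed
  show "tensor_assoc_inv (x \<otimes> (y \<otimes> z)) = (x \<otimes> y) \<otimes> z"
    by (simp add: tensor_assoc_inv_def tensor_lift_tensor_of[OF outer] tensor_lift_tensor_of[OF inner])
  show "clinear (tensor_assoc_inv :: 'a \<otimes> ('b \<otimes> 'c) \<Rightarrow> _)"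
    by (simp add: tensor_assoc_inv_def clinear_tensor_lift[OF outer])
qed

lemma tensor_unit_right_tensor_of:
  fixes y :: "'b::complex_vector"
  shows "tensor_unit_right (y \<otimes> c) = c *\<^sub>C y"
    and "clinear (tensor_unit_right :: 'b \<otimes> complex \<Rightarrow> 'b)"
proof -
  have "cbilinear (\<lambda>(y::'b) c. c *\<^sub>C y)"
    by (simp add: cbilinear_def clinear_iff scaleC_complex_def algebra_simps)
  then show "tensor_unit_right (y \<otimes> c) = c *\<^sub>C y"
    "clinear (tensor_unit_right :: 'b \<otimes> complex \<Rightarrow> 'b)"
    by (simp_all add: tensor_unit_right_def tensor_lift_tensor_of clinear_tensor_lift)
qed

lemma alg_mult_tensor_of:
  fixes x y :: "'a::complex_unital_algebra"
  shows "alg_mult (x \<otimes> y) = x * y"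
    and "clinear (alg_mult :: 'a \<otimes> 'a \<Rightarrow> 'a)"
proof -
  have "cbilinear ((*) :: 'a \<Rightarrow> 'a \<Rightarrow> 'a)"
    by (simp add: cbilinear_def clinear_iff distrib_left distrib_right mult_scaleC_left mult_scaleC_right)
  then show "alg_mult (x \<otimes> y) = x * y" "clinear (alg_mult :: 'a \<otimes> 'a \<Rightarrow> 'a)"
    by (simp_all add: alg_mult_def tensor_lift_tensor_of clinear_tensor_lift)
qed

end

theory Submission
  imports Defs
begin

text \<open>Write \<open>E\<^sub>X = id\<^sub>X \<otimes> \<epsilon>\<close>, read as a map \<open>X \<otimes> A \<rightarrow> X\<close>, so that \<open>Op(a)(b) = E\<^sub>B(\<sigma>(a \<otimes> b))\<close>.
  The compatibility of \<open>\<sigma>\<close> with \<open>\<mu>\<^sub>A\<close> rewrites \<open>\<sigma>(xy \<otimes> b)\<close> as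
  \<open>(id \<otimes> \<mu>\<^sub>A)(\<sigma>\<^sub>1\<^sub>2(\<sigma>\<^sub>2\<^sub>3(x \<otimes> y \<otimes> b)))\<close>.
  Since \<open>\<epsilon>\<close> is multiplicative, applying \<open>E\<^sub>B\<close> after \<open>\<mu>\<^sub>A\<close> evaluates the two
  \<open>A\<close>-factors one after the other, the last one first (\<open>eval_right_alg_mult\<close>).
  The last factor is not touched by \<open>\<sigma>\<^sub>1\<^sub>2\<close>, so its evaluation slides past \<open>\<sigma>\<^sub>1\<^sub>2\<close>
  (\<open>eval_right_leg12\<close>) and meets \<open>\<sigma>\<^sub>2\<^sub>3\<close>, where it turns \<open>\<sigma>(y \<otimes> b)\<close> into
  \<open>Op(y)(b)\<close> (\<open>eval_right_leg23\<close>). What remains is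
  \<open>E\<^sub>B(\<sigma>(x \<otimes> Op(y)(b))) = Op(x)(Op(y)(b))\<close>.
  The unit law is \<open>\<sigma>(1 \<otimes> b) = b \<otimes> 1\<close> together with \<open>\<epsilon>(1) = 1\<close>.\<close>

lemma clinear_comp: "clinear f \<Longrightarrow> clinear g \<Longrightarrow> clinear (g \<circ> f)"
  by (simp add: clinear_iff)

lemma clinear_id: "clinear id"
  by (simp add: clinear_iff)

lemma clinear_scale: "clinear f \<Longrightarrow> f (c *\<^sub>C x) = c *\<^sub>C f x"
  by (simp add: clinear_iff)

lemma clinear_tensor_of_left: "clinear (\<lambda>x. x \<otimes> y)"
  by (simp add: clinear_iff tensor_of_simps)

lemma clinear_tensor_of_right: "clinear (\<lambda>y. x \<otimes> y)"
  by (simp add: clinear_iff tensor_of_simps)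

text \<open>The left factor is an arbitrary space, since below it is \<open>B\<close> as well as \<open>A \<otimes> B\<close>
  and \<open>B \<otimes> A\<close>.\<close>

definition eval_right ::
    "('a::complex_vector \<Rightarrow> complex) \<Rightarrow> 'x::complex_vector \<otimes> 'a \<Rightarrow> 'x"
  where "eval_right \<epsilon> = tensor_unit_right \<circ> (id \<otimes>\<^sub>m \<epsilon>)"

lemma Op_eq_eval_right: "Op \<sigma> \<epsilon> a b = eval_right \<epsilon> (\<sigma> (a \<otimes> b))"
  by (simp add: Op_def eval_right_def)

lemma
  assumes "clinear \<epsilon>"
  shows eval_right_tensor_of: "eval_right \<epsilon> (x \<otimes> a) = \<epsilon> a *\<^sub>C x"
    and clinear_eval_right: "clinear (eval_right \<epsilon>)"
  using assms
  by (simp_all add: eval_right_def tensor_map_tensor_of clinear_id tensor_unit_right_tensor_of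
      clinear_comp)

text \<open>On pure tensors both sides of the next equation are \<open>\<epsilon>(a'a) x\<close>. With left bracketing, pure
  tensors of a triple product are reached by applying the extensionality principle
  \<open>clinear_tensor_eqI\<close> twice, the second time with the last factor held fixed.\<close>

lemma eval_right_alg_mult:
  fixes \<epsilon> :: "'a::complex_unital_algebra \<Rightarrow> complex"
    and u :: "('x::complex_vector \<otimes> 'a) \<otimes> 'a"
  assumes lin: "clinear \<epsilon>" and mult: "\<And>x y. \<epsilon> (x * y) = \<epsilon> x * \<epsilon> y"
  shows "eval_right \<epsilon> ((id \<otimes>\<^sub>m alg_mult) (tensor_assoc u)) = eval_right \<epsilon> (eval_right \<epsilon> u)"
proof -
  let ?m = "(id \<otimes>\<^sub>m alg_mult) \<circ> tensor_assoc :: ('x \<otimes> 'a) \<otimes> 'a \<Rightarrow> 'x \<otimes> 'a"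
  have lin_m: "clinear (eval_right \<epsilon> \<circ> ?m)"
    by (intro clinear_comp clinear_eval_right lin tensor_map_tensor_of clinear_id
        alg_mult_tensor_of tensor_assoc_tensor_of)
  have lin_EE: "clinear (eval_right \<epsilon> \<circ> eval_right \<epsilon> :: ('x \<otimes> 'a) \<otimes> 'a \<Rightarrow> 'x)"
    by (intro clinear_comp clinear_eval_right lin)
  have "eval_right \<epsilon> \<circ> ?m = eval_right \<epsilon> \<circ> eval_right \<epsilon>"
  proof (rule clinear_tensor_eqI[OF lin_m lin_EE])
    fix t :: "'x \<otimes> 'a" and a :: 'a
    have "(eval_right \<epsilon> \<circ> ?m) \<circ> (\<lambda>t. t \<otimes> a) = (eval_right \<epsilon> \<circ> eval_right \<epsilon>) \<circ> (\<lambda>t. t \<otimes> a)"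
    proof (rule clinear_tensor_eqI)
      fix x :: 'x and a' :: 'a
      show "((eval_right \<epsilon> \<circ> ?m) \<circ> (\<lambda>t. t \<otimes> a)) (x \<otimes> a')
          = ((eval_right \<epsilon> \<circ> eval_right \<epsilon>) \<circ> (\<lambda>t. t \<otimes> a)) (x \<otimes> a')"
        by (simp add: tensor_assoc_tensor_of tensor_map_tensor_of clinear_id alg_mult_tensor_of
            eval_right_tensor_of[OF lin] clinear_scale[OF clinear_eval_right[OF lin]] mult
            scaleC_scaleC mult.commute)
    qed (intro clinear_comp lin_m lin_EE clinear_tensor_of_left)+
    then show "(eval_right \<epsilon> \<circ> ?m) (t \<otimes> a) = (eval_right \<epsilon> \<circ> eval_right \<epsilon>) (t \<otimes> a)"
      by (simp add: fun_eq_iff)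
  qed
  then show ?thesis by (simp add: fun_eq_iff)
qed

text \<open>The two maps act on disjoint tensor factors; linearity of \<open>\<sigma>\<close> lets the scalar produced
  by \<open>\<epsilon>\<close> pass through it.\<close>

lemma eval_right_leg12:
  assumes "clinear \<epsilon>" "clinear \<sigma>"
  shows "eval_right \<epsilon> (leg12 \<sigma> u) = \<sigma> (eval_right \<epsilon> u)"
proof -
  have "eval_right \<epsilon> \<circ> leg12 \<sigma> = \<sigma> \<circ> eval_right \<epsilon>"
  proof (rule clinear_tensor_eqI)
    show "clinear (eval_right \<epsilon> \<circ> leg12 \<sigma>)" "clinear (\<sigma> \<circ> eval_right \<epsilon>)"
      by (simp_all add: assms leg12_def clinear_comp clinear_eval_right tensor_map_tensor_of
          clinear_id)
    show "(eval_right \<epsilon> \<circ> leg12 \<sigma>) (t \<otimes> a) = (\<sigma> \<circ> eval_right \<epsilon>) (t \<otimes> a)" for t a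
      using assms
      by (simp add: leg12_def tensor_map_tensor_of clinear_id eval_right_tensor_of clinear_iff)
  qed
  then show ?thesis by (simp add: fun_eq_iff)
qed

text \<open>Regrouping \<open>X \<otimes> (Y \<otimes> A)\<close> as \<open>(X \<otimes> Y) \<otimes> A\<close> does not affect the evaluation of \<open>A\<close>,
  so it may be carried out inside the right-hand factor.\<close>

lemma eval_right_tensor_assoc_inv:
  fixes x :: "'x::complex_vector" and t :: "'y::complex_vector \<otimes> 'a::complex_vector"
  assumes lin: "clinear \<epsilon>"
  shows "eval_right \<epsilon> (tensor_assoc_inv (x \<otimes> t)) = x \<otimes> eval_right \<epsilon> t"
proof -
  have "(eval_right \<epsilon> \<circ> tensor_assoc_inv) \<circ> (\<lambda>t. x \<otimes> t) = (\<lambda>y :: 'y. x \<otimes> y) \<circ> eval_right \<epsilon>"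
  proof (rule clinear_tensor_eqI)
    show "((eval_right \<epsilon> \<circ> tensor_assoc_inv) \<circ> (\<lambda>t. x \<otimes> t)) (y \<otimes> a)
        = ((\<lambda>y. x \<otimes> y) \<circ> eval_right \<epsilon>) (y \<otimes> a)" for y :: 'y and a
      by (simp add: tensor_assoc_inv_tensor_of eval_right_tensor_of[OF lin] tensor_of_simps)
  qed (intro clinear_comp clinear_eval_right lin tensor_assoc_inv_tensor_of
      clinear_tensor_of_right)+
  then show ?thesis by (simp add: fun_eq_iff)
qed

lemma eval_right_leg23:
  assumes "clinear \<epsilon>" "clinear \<sigma>"
  shows "eval_right \<epsilon> (leg23 \<sigma> ((x \<otimes> y) \<otimes> z)) = x \<otimes> eval_right \<epsilon> (\<sigma> (y \<otimes> z))"
  using assms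
  by (simp add: leg23_def tensor_assoc_tensor_of tensor_map_tensor_of clinear_id
      eval_right_tensor_assoc_inv)

theorem proposition2:
  fixes \<sigma> :: "'a::complex_unital_algebra \<otimes> 'b::complex_unital_algebra \<Rightarrow> 'b \<otimes> 'a"
    and \<epsilon> :: "'a \<Rightarrow> complex"
  assumes "clinear \<sigma>"
    and "\<sigma> \<circ> (alg_mult \<otimes>\<^sub>m id) = (id \<otimes>\<^sub>m alg_mult) \<circ> tensor_assoc \<circ> leg12 \<sigma> \<circ> leg23 \<sigma>"
    and "\<sigma> \<circ> (id \<otimes>\<^sub>m alg_mult) \<circ> tensor_assoc = (alg_mult \<otimes>\<^sub>m id) \<circ> leg23 \<sigma> \<circ> leg12 \<sigma>"
    and "\<And>b. \<sigma> (1 \<otimes> b) = b \<otimes> 1"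
    and "\<And>a. \<sigma> (a \<otimes> 1) = 1 \<otimes> a"
    and "unital_algebra_hom \<epsilon>"
  shows "algebra_representation (Op \<sigma> \<epsilon>)"
proof -
  have lin: "clinear \<epsilon>" and mult: "\<And>x y. \<epsilon> (x * y) = \<epsilon> x * \<epsilon> y" and one: "\<epsilon> 1 = 1"
    using assms(6) by (simp_all add: unital_algebra_hom_def)
  have lin_E\<sigma>: "clinear (eval_right \<epsilon> \<circ> \<sigma>)"
    by (intro clinear_comp clinear_eval_right lin assms(1))
  have "clinear (Op \<sigma> \<epsilon> a)" for a
    using clinear_comp[OF clinear_tensor_of_right[of a] lin_E\<sigma>]
    by (simp add: clinear_iff Op_eq_eval_right)
  moreover have "clinear (\<lambda>a. Op \<sigma> \<epsilon> a b)" for b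
    using clinear_comp[OF clinear_tensor_of_left[of b] lin_E\<sigma>]
    by (simp add: clinear_iff Op_eq_eval_right)
  moreover have "Op \<sigma> \<epsilon> (x * y) = Op \<sigma> \<epsilon> x \<circ> Op \<sigma> \<epsilon> y" for x y
  proof
    fix b
    have "\<sigma> ((x * y) \<otimes> b) = (\<sigma> \<circ> (alg_mult \<otimes>\<^sub>m id)) ((x \<otimes> y) \<otimes> b)"
      by (simp add: tensor_map_tensor_of alg_mult_tensor_of clinear_id)
    also have "\<dots> = (id \<otimes>\<^sub>m alg_mult) (tensor_assoc (leg12 \<sigma> (leg23 \<sigma> ((x \<otimes> y) \<otimes> b))))"
      by (simp only: assms(2) comp_apply)
    finally show "Op \<sigma> \<epsilon> (x * y) b = (Op \<sigma> \<epsilon> x \<circ> Op \<sigma> \<epsilon> y) b"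
      by (simp add: Op_eq_eval_right eval_right_alg_mult[OF lin mult]
          eval_right_leg12[OF lin assms(1)] eval_right_leg23[OF lin assms(1)])
  qed
  moreover have "Op \<sigma> \<epsilon> 1 = id"
    by (simp add: fun_eq_iff Op_eq_eval_right assms(4) eval_right_tensor_of[OF lin] one scaleC_one)
  ultimately show ?thesis by (simp add: algebra_representation_def)
qed

end
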